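(* Let $X$ be a nonempty set, $n\ge1$, and let $\mathcal{U}$ be an $n$-minimal constructible family of subsets of $X$. If $\mathcal{H}\subseteq\mathcal{U}$, then $\mathcal{H}$ is $n$-minimal constructible.
   Context: For a family $\mathcal{U}$ of subsets of $X$, let $C_1(\mathcal{U})$ be the family of all sets of the form $E_1\cap E_2$, $E_1\cup E_2$ or $X\setminus E_1$ with $E_1,E_2\in\mathcal{U}$ (possibly $E_1=E_2$). Set $C_0(\mathcal{U})=\mathcal{U}$ and $C_n(\mathcal{U})=C_1(C_{n-1}(\mathcal{U}))$ for $n\ge1$. A family $\mathcal{U}$ is $n$-minimal constructible ($n\ge1$) if for every proper subfamily $\mathcal{H}\subsetneq\mathcal{U}$ we have $\mathcal{U}\not\subseteq C_n(\mathcal{H})$. *)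

theory Defs
  imports Main
begin

text \<open>The ground set \<^term>\<open>X\<close> is an explicit set, and complements are taken relative to it.
  The constants do not themselves require \<^term>\<open>U \<subseteq> Pow X\<close>; statements assume it.\<close>

definition constr_step :: "'a set \<Rightarrow> 'a set set \<Rightarrow> 'a set set" where
  "constr_step X U =
     {E1 \<inter> E2 | E1 E2. E1 \<in> U \<and> E2 \<in> U} \<union>
     {E1 \<union> E2 | E1 E2. E1 \<in> U \<and> E2 \<in> U} \<union>
     {X - E1 | E1. E1 \<in> U}"

primrec constr :: "'a set \<Rightarrow> nat \<Rightarrow> 'a set set \<Rightarrow> 'a set set" where
  "constr X 0 U = U"
| "constr X (Suc n) U = constr_step X (constr X n U)"

text \<open>Intended for \<^term>\<open>n \<ge> (1::nat)\<close>, which statements assume.\<close>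

definition minimal_constructible :: "'a set \<Rightarrow> nat \<Rightarrow> 'a set set \<Rightarrow> bool" where
  "minimal_constructible X n U \<longleftrightarrow> (\<forall>H. H \<subset> U \<longrightarrow> \<not> U \<subseteq> constr X n H)"

end

theory Submission
  imports Defs
begin

text \<open>Contraposition: if a proper subfamily K of H generates H in n steps, then K together
  with U - H generates U in n steps, contradicting minimality of U. This rests on
  \<open>constr\<close> being monotone in the family (\<open>constr_mono\<close>) and never losing
  its generators (\<open>subset_constr\<close>).\<close>

lemma constr_step_mono: "U \<subseteq> V \<Longrightarrow> constr_step X U \<subseteq> constr_step X V"
  unfolding constr_step_def by blast

text \<open>The two operands may coincide, and E = E \<inter> E.\<close>

lemma subset_constr_step: "U \<subseteq> constr_step X U"
  unfolding constr_step_def by blast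

lemma constr_mono: "U \<subseteq> V \<Longrightarrow> constr X n U \<subseteq> constr X n V"
  by (induction n) (simp_all add: constr_step_mono)

lemma subset_constr: "U \<subseteq> constr X n U"
  by (induction n) (use subset_constr_step in fastforce)+

theorem theorem6p9:
  fixes X :: "'a set" and n :: nat and U H :: "'a set set"
  assumes "X \<noteq> {}"
    and "n \<ge> 1"
    and "U \<subseteq> Pow X"
    and "minimal_constructible X n U"
    and "H \<subseteq> U"
  shows "minimal_constructible X n H"
  unfolding minimal_constructible_def
proof (intro allI impI notI)
  fix K
  assume K: "K \<subset> H" "H \<subseteq> constr X n K"
  let ?K = "K \<union> (U - H)"
  have "H \<subseteq> constr X n ?K"
    using K(2) constr_mono[of K ?K X n] by blast
  moreover have "U - H \<subseteq> constr X n ?K"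
    using subset_constr[of ?K X n] by blast
  ultimately have "U \<subseteq> constr X n ?K"
    by blast
  \<comment> \<open>Properness: a member of H - K lies in U, but neither in K nor in U - H.\<close>
  moreover have "?K \<subset> U"
    using K(1) assms(5) by blast
  ultimately show False
    using assms(4) unfolding minimal_constructible_def by blast
qed

end
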